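(* Let $q,z\in\mathbb{C}$ with $|q|<1$ and $z\ne0$. Then $$\sum_{n=0}^\infty \frac{(-q/z,-zq)_n}{(q)_{2n+1}}q^{n(n+1)}=\frac{(-q^3/z,-zq^3,q^3;q^3)_\infty}{(q)_\infty}$$ and $$\sum_{n=0}^\infty \frac{(-q/z,-zq,-q)_n}{(q)_{2n+1}}q^{\binom{n+1}{2}}=\frac{(-q^2/z,-zq^2;q^2)_\infty}{(q;q^2)_\infty^2}.$$
   Context: $(a;p)_n=\prod_{j=1}^{n}(1-ap^{j-1})$ for $n\ge0$ (with $(a;p)_0=1$), $(a;p)_\infty=\prod_{j\ge0}(1-ap^j)$, $(a_1,\dots,a_m;p)_n=\prod_i(a_i;p)_n$ and likewise with $n=\infty$; when the base is omitted it is $q$. *)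

theory Defs
  imports "HOL-Analysis.Analysis"
begin

definition qpoch :: "complex \<Rightarrow> complex \<Rightarrow> nat \<Rightarrow> complex" where
  "qpoch a p n = (\<Prod>j=1..n. 1 - a * p ^ (j - 1))"

definition qpoch_inf :: "complex \<Rightarrow> complex \<Rightarrow> complex" where
  "qpoch_inf a p = (\<Prod>j. 1 - a * p ^ j)"

text \<open>The multi-parameter symbols: the list argument is the tuple of numerator parameters.\<close>

definition qpochs :: "complex list \<Rightarrow> complex \<Rightarrow> nat \<Rightarrow> complex" where
  "qpochs as p n = (\<Prod>a\<leftarrow>as. qpoch a p n)"

definition qpochs_inf :: "complex list \<Rightarrow> complex \<Rightarrow> complex" where
  "qpochs_inf as p = (\<Prod>a\<leftarrow>as. qpoch_inf a p)"

text \<open>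
  For \<open>norm p < 1\<close> the infinite product converges (also when some factor vanishes), so
  \<^const>\<open>qpoch_inf\<close> is the limit of the finite symbols rather than an unspecified value.
\<close>

lemma convergent_prod_qpoch:
  fixes a p :: complex
  assumes "norm p < 1"
  shows "convergent_prod (\<lambda>j. 1 - a * p ^ j)"
proof (rule abs_convergent_prod_imp_convergent_prod)
  have "summable (\<lambda>j. norm a * norm p ^ j)"
    using assms by (intro summable_mult summable_geometric) auto
  then show "abs_convergent_prod (\<lambda>j. 1 - a * p ^ j)"
    by (simp add: abs_convergent_prod_conv_summable norm_mult norm_power)
qed

lemma qpoch_tendsto_qpoch_inf:
  assumes "norm p < 1"
  shows "qpoch a p \<longlonglongrightarrow> qpoch_inf a p"
proof -
  have "(\<lambda>n. \<Prod>j\<le>n. 1 - a * p ^ j) \<longlonglongrightarrow> qpoch_inf a p"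
    unfolding qpoch_inf_def
    by (rule convergent_prod_LIMSEQ[OF convergent_prod_qpoch[OF assms]])
  moreover have "(\<Prod>j\<le>n. 1 - a * p ^ j) = qpoch a p (Suc n)" for n
    unfolding qpoch_def
    by (rule prod.reindex_bij_witness[of _ "\<lambda>j. j - 1" Suc]) auto
  ultimately have "(\<lambda>n. qpoch a p (Suc n)) \<longlonglongrightarrow> qpoch_inf a p"
    by simp
  then show ?thesis
    by (rule LIMSEQ_imp_Suc)
qed

end

theory Submission
  imports Defs
begin

text \<open>
  With \<open>P\<^sub>r(z) = (z\<^sup>r\<^sup>+\<^sup>1 + z\<^sup>-\<^sup>r) / (1 + z)\<close>, the finite Jacobi triple product reads
  \<open>(-q/z, -zq)\<^sub>n / (q)\<^sub>2\<^sub>n\<^sub>+\<^sub>1 = \<Sum>\<^sub>r q\<^sup>r\<^sup>(\<^sup>r\<^sup>+\<^sup>1\<^sup>)\<^sup>/\<^sup>2 P\<^sub>r(z) / ((q)\<^sub>n\<^sub>-\<^sub>r (q)\<^sub>n\<^sub>+\<^sub>r\<^sub>+\<^sub>1)\<close>.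
  Insert it in both series and sum over \<open>n\<close> first. The inner sums are limiting cases of the q-Gauss
  sum; they multiply the \<open>r\<close>-th term by a constant times \<open>q\<^sup>r\<^sup>(\<^sup>r\<^sup>+\<^sup>1\<^sup>)\<close>, respectively
  \<open>q\<^sup>r\<^sup>(\<^sup>r\<^sup>+\<^sup>1\<^sup>)\<^sup>/\<^sup>2\<close>, so what remains is the triple product series with base \<open>q\<^sup>3\<close>,
  respectively \<open>q\<^sup>2\<close>.
\<close>

section \<open>Triangular exponents\<close>

lemma choose_2_Suc: "Suc n choose 2 = (n choose 2) + n"
  by (simp add: numeral_2_eq_2)

lemma choose_2_add: "(m + n) choose 2 = (m choose 2) + (n choose 2) + m * n"
  by (induction n) (simp_all add: choose_2_Suc)

text \<open>Separates the weight at \<open>n = m + r\<close>: the power depending on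
  \<open>r\<close> alone leaves the sum over \<open>m\<close>, while \<open>q ^ (m choose 2)\<close>
  and the mixed part are absorbed by the q-Gauss term.\<close>

lemma power_Suc_add_choose_2:
  fixes q :: "'a :: comm_monoid_mult"
  shows "q ^ (Suc (m + r) choose 2) = q ^ (m choose 2) * q ^ (Suc r choose 2) * (q ^ (r + 1)) ^ m"
proof -
  have "Suc (m + r) choose 2 = (m choose 2) + (Suc r choose 2) + (r + 1) * m"
    using choose_2_add[of m "r + 1"] by (simp add: mult.commute)
  then show ?thesis
    by (simp only: power_add power_mult)
qed

lemma Suc_choose_2_double: "2 * (Suc n choose 2) = n * (n + 1)"
  by (induction n) (simp_all add: choose_2_Suc)

section \<open>The symbols \<open>qpoch q q n\<close> and their reciprocals\<close>

lemma qpoch_0 [simp]: "qpoch a p 0 = 1"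
  by (simp add: qpoch_def)

lemma qpoch_Suc [simp]: "qpoch a p (Suc n) = qpoch a p n * (1 - a * p ^ n)"
  by (simp add: qpoch_def)

lemma qpoch_add: "qpoch a p (m + n) = qpoch a p m * qpoch (a * p ^ m) p n"
  by (induction n) (simp_all add: power_add mult_ac)

lemma one_minus_mult_power_nz:
  fixes q :: complex
  assumes "norm q < 1"
  shows "1 - q * q ^ n \<noteq> 0"
proof
  assume "1 - q * q ^ n = 0"
  then have "norm (q ^ Suc n) = 1" by simp
  moreover have "norm (q ^ Suc n) < 1"
    using assms by (subst norm_power) (simp add: power_less_one_iff del: power_Suc)
  ultimately show False by simp
qed

text \<open>Oriented upwards on purpose: reciprocals at smaller indices get expressed through one at
  a larger index, the common value needed in the kernel recurrence.\<close>

lemma inverse_qpoch_self_Suc: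
  assumes "norm q < 1"
  shows "inverse (qpoch q q n) = inverse (qpoch q q (Suc n)) * (1 - q ^ Suc n)"
  using one_minus_mult_power_nz[OF assms, of n] by simp

lemma qpoch_inf_self_nz:
  assumes "norm q < 1"
  shows "qpoch_inf q q \<noteq> 0"
  unfolding qpoch_inf_def
  by (rule prodinf_nonzero[OF convergent_prod_qpoch[OF assms] one_minus_mult_power_nz[OF assms]])

lemma inverse_qpoch_self_tendsto:
  assumes "norm q < 1"
  shows "(\<lambda>n. inverse (qpoch q q n)) \<longlonglongrightarrow> inverse (qpoch_inf q q)"
  by (intro tendsto_inverse qpoch_tendsto_qpoch_inf qpoch_inf_self_nz assms)

lemma inverse_qpoch_self_bounded:
  assumes "norm q < 1"
  obtains B where "B > 0" "\<And>n. norm (inverse (qpoch q q n)) \<le> B"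
proof -
  have "Bseq (\<lambda>n. inverse (qpoch q q n))"
    using inverse_qpoch_self_tendsto[OF assms] by (intro convergent_imp_Bseq) (auto simp: convergent_def)
  then show ?thesis
    using that by (auto elim!: BseqE)
qed

section \<open>Dominated convergence and majorant series\<close>

lemma tannery_sequentially:
  fixes a :: "nat \<Rightarrow> nat \<Rightarrow> 'a :: {real_normed_algebra, banach}"
  assumes "\<And>k. (\<lambda>n. a k n) \<longlonglongrightarrow> b k"
    and "\<And>k n. norm (a k n) \<le> M k"
    and "summable M"
  shows "summable b" "(\<lambda>n. \<Sum>k. a k n) \<longlonglongrightarrow> suminf b"
proof -
  have *: "eventually (\<lambda>n. summable (\<lambda>k. norm (a k n))) sequentially \<and>
           summable (\<lambda>n. norm (b n)) \<and> (\<lambda>n. \<Sum>k. a k n) \<longlonglongrightarrow> suminf b"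
    using assms by (intro tannerys_theorem[of a b sequentially M]) (auto simp: case_prod_unfold)
  then show "summable b" "(\<lambda>n. \<Sum>k. a k n) \<longlonglongrightarrow> suminf b"
    by (auto intro: summable_norm_cancel)
qed

text \<open>Consecutive terms have ratio \<open>x ^ n * K\<close>, which tends to 0, so
  \<open>K\<close> may be arbitrarily large.\<close>

lemma summable_power_choose_2:
  fixes x K :: real
  assumes "0 \<le> x" "x < 1" "0 \<le> K"
  shows "summable (\<lambda>n. x ^ (n choose 2) * K ^ n)"
proof -
  have "(\<lambda>n. x ^ n * K) \<longlonglongrightarrow> 0"
    using assms by (intro tendsto_mult_left_zero LIMSEQ_realpow_zero) auto
  then have "eventually (\<lambda>n. x ^ n * K < 1 / 2) sequentially"
    by (rule order_tendstoD) auto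
  then obtain N where N: "\<And>n. n \<ge> N \<Longrightarrow> x ^ n * K < 1 / 2"
    by (auto simp: eventually_sequentially)
  show ?thesis
  proof (rule summable_ratio_test[where c = "1 / 2" and N = N])
    fix n assume "n \<ge> N"
    have "(x ^ n * K) * (x ^ (n choose 2) * K ^ n) \<le> 1 / 2 * (x ^ (n choose 2) * K ^ n)"
      using N[OF \<open>n \<ge> N\<close>] assms by (intro mult_right_mono) auto
    then show "norm (x ^ (Suc n choose 2) * K ^ Suc n) \<le> 1 / 2 * norm (x ^ (n choose 2) * K ^ n)"
      using assms by (simp add: choose_2_Suc power_add mult_ac)
  qed auto
qed

lemma summable_power_Suc_choose_2:
  fixes x K :: real
  assumes "0 \<le> x" "x < 1" "0 \<le> K"
  shows "summable (\<lambda>n. x ^ (Suc n choose 2) * K ^ n)"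
  using summable_power_choose_2[OF assms(1,2), of "x * K"] assms
  by (simp add: choose_2_Suc power_add power_mult_distrib mult_ac)

section \<open>A finite form of the Jacobi triple product\<close>

text \<open>
  The Laurent polynomial \<open>(z\<^sup>r\<^sup>+\<^sup>1 + z\<^sup>-\<^sup>r) / (1 + z)\<close>, defined without the division so that
  \<open>z = -1\<close> is not exceptional.
\<close>

fun jacobi_poly :: "complex \<Rightarrow> nat \<Rightarrow> complex" where
  "jacobi_poly z 0 = 1"
| "jacobi_poly z (Suc r) = z ^ Suc r + inverse z ^ Suc r - jacobi_poly z r"

text \<open>Multiplication by \<open>z + inverse z\<close> shifts the index both ways. At
  \<open>r = 0\<close> the truncated \<open>r - 1 = 0\<close> is the correct neighbour, because the
  Laurent polynomials are symmetric under \<open>r\<close> to \<open>-r - 1\<close>.\<close>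

lemma jacobi_poly_mult:
  assumes "z \<noteq> 0"
  shows "(z + inverse z) * jacobi_poly z r = jacobi_poly z (Suc r) + jacobi_poly z (r - 1)"
proof (induction r)
  case (Suc r)
  have "(z + inverse z) * (z ^ Suc r + inverse z ^ Suc r)
      = z ^ Suc (Suc r) + inverse z ^ Suc (Suc r) + z ^ r + inverse z ^ r"
    using assms by (simp add: field_simps)
  moreover have "z ^ r + inverse z ^ r = jacobi_poly z r + jacobi_poly z (r - 1)"
    if "r > 0"
    using that by (cases r) auto
  ultimately show ?case
    using Suc by (cases "r = 0") (auto simp: algebra_simps)
qed simp

lemma norm_jacobi_poly_le:
  obtains K where "K > 0" "\<And>r. norm (jacobi_poly z r) \<le> K ^ r"
proof -
  define M where "M = max 1 (max (norm z) (norm (inverse z)))"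
  have M: "M \<ge> 1" "norm z \<le> M" "norm (inverse z) \<le> M"
    by (auto simp: M_def)
  \<comment> \<open>The factor 3 counts the summands of the recursion, each of which is at most
    \<open>M * (3 * M) ^ r\<close>.\<close>
  have "norm (jacobi_poly z r) \<le> (3 * M) ^ r" for r
  proof (induction r)
    case (Suc r)
    have "norm (z ^ Suc r) \<le> M ^ Suc r" "norm (inverse z ^ Suc r) \<le> M ^ Suc r"
      unfolding norm_power using M by (auto intro!: power_mono simp del: power_Suc)
    moreover have "M ^ Suc r \<le> M * (3 * M) ^ r"
      using M by (auto intro!: mult_left_mono power_mono)
    moreover have "(3 * M) ^ r \<le> M * (3 * M) ^ r"
      using M by auto
    moreover have "norm (jacobi_poly z (Suc r))
        \<le> norm (z ^ Suc r) + norm (inverse z ^ Suc r) + norm (jacobi_poly z r)"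
      unfolding jacobi_poly.simps by (meson norm_triangle_ineq norm_triangle_ineq4 add_right_mono order_trans)
    ultimately have "norm (jacobi_poly z (Suc r)) \<le> 3 * (M * (3 * M) ^ r)"
      using Suc by linarith
    then show ?case by simp
  qed simp
  with M show ?thesis
    by (intro that[of "3 * M"]) auto
qed

text \<open>Up to the factor \<open>1 - q\<close>, this is the kernel
  \<open>1 / ((q)_(n-r) (aq)_(n+r))\<close> of Bailey pairs at \<open>a = q\<close>. The value 0 for
  \<open>r > n\<close> reflects the convention that \<open>1 / (q)_k\<close> vanishes for negative
  \<open>k\<close>.\<close>

definition bailey_kernel :: "complex \<Rightarrow> nat \<Rightarrow> nat \<Rightarrow> complex" where
  "bailey_kernel q n r =
     (if r \<le> n then inverse (qpoch q q (n - r)) * inverse (qpoch q q (n + r + 1)) else 0)"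

lemma norm_bailey_kernel_le:
  assumes "norm q < 1"
  obtains B where "B > 0" "\<And>n r. norm (bailey_kernel q n r) \<le> B"
proof -
  obtain B where B: "B > 0" "\<And>n. norm (inverse (qpoch q q n)) \<le> B"
    using inverse_qpoch_self_bounded[OF assms] by blast
  have "norm (bailey_kernel q n r) \<le> B * B" for n r
    using B(1) unfolding bailey_kernel_def
    by (auto simp: norm_mult simp del: norm_inverse qpoch_Suc intro!: mult_mono B(2))
  with B show ?thesis
    by (intro that[of "B * B"]) auto
qed

text \<open>This mirrors the expansion \<open>(1 + e/z) (1 + z e) = 1 + e^2 + e (z + 1/z)\<close>
  with \<open>e = q ^ Suc n\<close>, the last term becoming the two shifts in \<open>r\<close>. All
  kernel values at \<open>n\<close> are multiples of the single value \<open>X\<close> at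
  \<open>Suc n\<close>, which leaves a polynomial identity in \<open>q\<close>, \<open>q ^ r\<close>
  and \<open>q ^ d\<close>.\<close>

lemma bailey_kernel_rec:
  fixes q :: complex and n r :: nat
  assumes "norm q < 1" "r \<le> Suc n"
  defines "A \<equiv> (\<lambda>n r. q ^ (Suc r choose 2) * bailey_kernel q n r)"
  shows "(1 - q ^ (2 * n + 2)) * (1 - q ^ (2 * n + 3)) * A (Suc n) r
    = (1 + q ^ (2 * n + 2)) * A n r + q ^ Suc n * (A n (r - 1) + A n (Suc r))"
proof -
  obtain d where d: "Suc n = r + d"
    using assms(2) le_Suc_ex by blast
  define X where "X = bailey_kernel q (Suc n) r"
  define w where "w = q ^ (r choose 2)"
  note inv = inverse_qpoch_self_Suc[OF assms(1)]
  have X: "X = inverse (qpoch q q d) * inverse (qpoch q q (n + r + 2))"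
  proof -
    have "Suc n - r = d" using d by simp
    then show ?thesis
      using assms(2) by (simp add: X_def bailey_kernel_def del: qpoch_Suc)
  qed
  have k0: "bailey_kernel q n r = X * (1 - q ^ d) * (1 - q ^ (n + r + 2))"
  proof (cases d)
    case 0
    then show ?thesis using d by (simp add: bailey_kernel_def)
  next
    case (Suc e)
    then have "bailey_kernel q n r = inverse (qpoch q q e) * inverse (qpoch q q (Suc (n + r)))"
      using d by (simp add: bailey_kernel_def del: qpoch_Suc)
    then show ?thesis
      unfolding inv[of e] inv[of "Suc (n + r)"] X Suc
      by (simp add: mult_ac del: qpoch_Suc power_Suc)
  qed
  \<comment> \<open>For \<open>r = 0\<close> the truncated index 0 gives the same value as the
    formal index -1, since the reflection \<open>r\<close> to \<open>-r - 1\<close> swaps the two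
    factors of the kernel.\<close>
  have k1: "bailey_kernel q n (r - 1) = X * (1 - q ^ (n + r + 1)) * (1 - q ^ (n + r + 2))"
  proof (cases r)
    case 0
    then have "bailey_kernel q n (r - 1) = inverse (qpoch q q n) * inverse (qpoch q q (Suc n))"
      by (simp add: bailey_kernel_def del: qpoch_Suc)
    also have "\<dots> = inverse (qpoch q q (Suc n)) * (1 - q ^ Suc n)
        * (inverse (qpoch q q (Suc (Suc n))) * (1 - q ^ Suc (Suc n)))"
      by (simp only: inv[of n] inv[of "Suc n"])
    finally show ?thesis
      using 0 d by (simp add: X mult_ac del: qpoch_Suc power_Suc)
  next
    case (Suc s)
    then have "bailey_kernel q n (r - 1) = inverse (qpoch q q d) * inverse (qpoch q q (n + r))"
      using d by (simp add: bailey_kernel_def del: qpoch_Suc)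
    then show ?thesis
      unfolding inv[of "n + r"] inv[of "Suc (n + r)"] X
      by (simp add: mult_ac del: qpoch_Suc power_Suc)
  qed
  \<comment> \<open>For \<open>d = 0\<close> and \<open>d = 1\<close> the kernel is 0, and so is the
    right-hand side: its factor \<open>1 - q ^ d\<close>, respectively
    \<open>1 - q ^ (d - 1)\<close>, vanishes.\<close>
  have k2: "bailey_kernel q n (Suc r) = X * (1 - q ^ d) * (1 - q ^ (d - 1))"
  proof (cases "d < 2")
    case True
    then have "d = 0 \<or> d = 1" by auto
    then show ?thesis using d by (auto simp: bailey_kernel_def)
  next
    case False
    then obtain e where e: "d = Suc (Suc e)"
      by (metis add_2_eq_Suc le_Suc_ex not_less)
    then have "bailey_kernel q n (Suc r) = inverse (qpoch q q e) * inverse (qpoch q q (n + r + 2))"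
      using d by (simp add: bailey_kernel_def del: qpoch_Suc)
    then show ?thesis
      unfolding inv[of e] inv[of "Suc e"] X e
      by (simp add: mult_ac del: qpoch_Suc power_Suc)
  qed
  define y D where "y = q ^ r" and "D = q ^ d"
  have e1: "q ^ Suc n = y * D"
    by (simp only: d y_def D_def power_add)
  have e2: "q ^ (2 * n + 2) = (y * D)\<^sup>2"
    unfolding e1[symmetric] power_mult[symmetric] by (simp add: mult.commute)
  have e3: "q ^ (2 * n + 3) = q * (y * D)\<^sup>2"
    unfolding e2[symmetric] by (simp add: eval_nat_numeral)
  have e4: "q ^ (n + r + 1) = y\<^sup>2 * D"
  proof -
    have "n + r + 1 = r * 2 + d" using d by simp
    then show ?thesis by (simp only: y_def D_def power_add power_mult)
  qed
  have e5: "q ^ (n + r + 2) = q * (y\<^sup>2 * D)"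
    unfolding e4[symmetric] by simp
  have c1: "q ^ (Suc r choose 2) = w * y"
    by (simp add: choose_2_Suc power_add w_def y_def)
  have c2: "q ^ (Suc (Suc r) choose 2) = w * y\<^sup>2 * q"
    by (simp add: choose_2_Suc[of "Suc r"] power_add c1 power2_eq_square) (simp add: y_def)
  have c0: "q ^ (Suc (r - 1) choose 2) = w"
    by (cases r) (simp_all add: w_def numeral_2_eq_2)
  have a0: "A (Suc n) r = w * y * X" "A n r = w * y * (X * (1 - D) * (1 - q * (y\<^sup>2 * D)))"
    by (simp_all only: A_def c1 k0 e5 X_def D_def)
  have a1: "A n (r - 1) = w * (X * (1 - y\<^sup>2 * D) * (1 - q * (y\<^sup>2 * D)))"
    by (simp only: A_def c0 k1 e4 e5)
  have a2: "A n (Suc r) = w * y\<^sup>2 * q * (X * (1 - D) * (1 - q ^ (d - 1)))"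
    by (simp only: A_def c2 k2 D_def)
  \<comment> \<open>The factor \<open>q\<close> turns \<open>q ^ (d - 1)\<close> into
    \<open>D\<close>; for \<open>d = 0\<close> both sides vanish because
    \<open>D = 1\<close>.\<close>
  have a3: "D * A n (Suc r) = w * y\<^sup>2 * X * (1 - D) * D * (q - D)"
    unfolding a2 by (cases d) (auto simp: D_def algebra_simps)
  have "y * D * (A n (r - 1) + A n (Suc r)) = y * D * A n (r - 1) + y * (D * A n (Suc r))"
    by (simp only: distrib_left mult.assoc)
  then show ?thesis
    unfolding e1 e2 e3 a3 a0 a1 by (simp add: algebra_simps power2_eq_square)
qed

text \<open>Summation by parts moves the shifts from the polynomials to the coefficients. Only the
  upper end leaves boundary terms: at the lower end both sequences are reflected in the same way by
  \<open>0 - 1 = 0\<close>.\<close>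

lemma jacobi_poly_sum_mult:
  assumes "z \<noteq> 0"
  shows "(z + inverse z) * (\<Sum>r\<le>N. A r * jacobi_poly z r)
    = (\<Sum>r\<le>N. (A (r - 1) + A (Suc r)) * jacobi_poly z r)
      + A N * jacobi_poly z (Suc N) - A (Suc N) * jacobi_poly z N"
proof (induction N)
  case 0
  then show ?case using jacobi_poly_mult[OF assms, of 0] by (simp add: algebra_simps)
next
  case (Suc N)
  have "(z + inverse z) * (\<Sum>r\<le>Suc N. A r * jacobi_poly z r)
    = (z + inverse z) * (\<Sum>r\<le>N. A r * jacobi_poly z r)
      + A (Suc N) * ((z + inverse z) * jacobi_poly z (Suc N))"
    by (simp add: algebra_simps)
  then show ?case
    unfolding Suc jacobi_poly_mult[OF assms]
    by (simp add: algebra_simps del: jacobi_poly.simps)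
qed

text \<open>By induction on \<open>n\<close>: passing to \<open>Suc n\<close> multiplies the left
  side by \<open>(1 + e/z) (1 + z e) / c\<close>, and the kernel recurrence does the same to the
  right side.\<close>

lemma finite_jacobi_triple_product:
  fixes q z :: complex
  assumes "norm q < 1" "z \<noteq> 0"
  shows "qpoch (- q / z) q n * qpoch (- z * q) q n / qpoch q q (2 * n + 1)
    = (\<Sum>r\<le>n. q ^ (Suc r choose 2) * bailey_kernel q n r * jacobi_poly z r)"
proof (induction n)
  case 0
  then show ?case by (simp add: bailey_kernel_def numeral_2_eq_2 field_simps)
next
  case (Suc n)
  define A where "A n r = q ^ (Suc r choose 2) * bailey_kernel q n r" for n r
  define e where "e = q ^ Suc n"
  define c where "c = (1 - q ^ (2 * n + 2)) * (1 - q ^ (2 * n + 3))"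
  have c: "c \<noteq> 0"
    using one_minus_mult_power_nz[OF assms(1), of "2 * n + 1"]
      one_minus_mult_power_nz[OF assms(1), of "2 * n + 2"]
    by (simp add: c_def eval_nat_numeral)
  \<comment> \<open>These zeros kill both boundary terms of the summation by parts at
    \<open>N = Suc n\<close>.\<close>
  have A0: "A n (Suc n) = 0" "A n (Suc (Suc n)) = 0"
    by (simp_all add: A_def bailey_kernel_def)
  have "c * (\<Sum>r\<le>Suc n. A (Suc n) r * jacobi_poly z r)
    = (\<Sum>r\<le>Suc n. ((1 + q ^ (2 * n + 2)) * A n r + e * (A n (r - 1) + A n (Suc r)))
        * jacobi_poly z r)"
    unfolding sum_distrib_left A_def c_def e_def
    using bailey_kernel_rec[OF assms(1)]
    by (intro sum.cong refl) (simp only: mult.assoc[symmetric] atMost_iff)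
  also have "\<dots> = (1 + q ^ (2 * n + 2)) * (\<Sum>r\<le>Suc n. A n r * jacobi_poly z r)
      + e * (\<Sum>r\<le>Suc n. (A n (r - 1) + A n (Suc r)) * jacobi_poly z r)"
    unfolding sum_distrib_left sum.distrib[symmetric]
    by (intro sum.cong refl) (simp add: algebra_simps)
  also have "(\<Sum>r\<le>Suc n. (A n (r - 1) + A n (Suc r)) * jacobi_poly z r)
      = (z + inverse z) * (\<Sum>r\<le>Suc n. A n r * jacobi_poly z r)"
    using jacobi_poly_sum_mult[OF assms(2), where A = "A n" and N = "Suc n"] A0 by simp
  also have "(\<Sum>r\<le>Suc n. A n r * jacobi_poly z r) = (\<Sum>r\<le>n. A n r * jacobi_poly z r)"
    using A0 by simp
  also have "(1 + q ^ (2 * n + 2)) * (\<Sum>r\<le>n. A n r * jacobi_poly z r)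
      + e * ((z + inverse z) * (\<Sum>r\<le>n. A n r * jacobi_poly z r))
    = (1 + e * inverse z) * (1 + z * e) * (\<Sum>r\<le>n. A n r * jacobi_poly z r)"
  proof -
    have "(1 + Q) * S + e * ((z + y) * S) = (1 + e * y) * (1 + z * e) * S"
      if "Q = e * e" "y * z = 1" for Q S y
      using that by algebra
    moreover have "q ^ (2 * n + 2) = e * e"
      by (simp add: e_def mult_2 power_add)
    moreover have "inverse z * z = 1" using assms by simp
    ultimately show ?thesis by blast
  qed
  also have "\<dots> = (1 + e * inverse z) * (1 + z * e)
      * (qpoch (- q / z) q n * qpoch (- z * q) q n / qpoch q q (2 * n + 1))"
    unfolding Suc A_def by simp
  also have "\<dots> = c * (qpoch (- q / z) q (Suc n) * qpoch (- z * q) q (Suc n) / qpoch q q (2 * Suc n + 1))"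
  proof -
    have "qpoch q q (2 * Suc n + 1) = qpoch q q (2 * n + 1) * c"
      by (simp add: c_def eval_nat_numeral)
    moreover have "qpoch (- q / z) q (Suc n) = qpoch (- q / z) q n * (1 + e * inverse z)"
      "qpoch (- z * q) q (Suc n) = qpoch (- z * q) q n * (1 + z * e)"
      by (simp_all add: e_def divide_inverse mult_ac)
    ultimately show ?thesis
      using c by (simp del: qpoch_Suc)
  qed
  finally have "(\<Sum>r\<le>Suc n. A (Suc n) r * jacobi_poly z r)
      = qpoch (- q / z) q (Suc n) * qpoch (- z * q) q (Suc n) / qpoch q q (2 * Suc n + 1)"
    using c by (simp only: mult_cancel_left simp_thms)
  then show ?case
    by (simp only: A_def)
qed

lemma finite_jacobi_triple_product_sums:
  fixes q z :: complex
  assumes "norm q < 1" "z \<noteq> 0"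
  shows "(\<lambda>r. q ^ (Suc r choose 2) * bailey_kernel q n r * jacobi_poly z r)
    sums (qpoch (- q / z) q n * qpoch (- z * q) q n / qpoch q q (2 * n + 1))"
  unfolding finite_jacobi_triple_product[OF assms]
  by (rule sums_finite) (auto simp: bailey_kernel_def)

text \<open>Let \<open>n\<close> tend to infinity in the finite form; each kernel value tends to
  \<open>1 / (q)_inf^2\<close>. The series is the usual bilateral theta series with the terms paired
  and the factor \<open>1 + z\<close> divided out.\<close>

lemma jacobi_triple_product:
  fixes q z :: complex
  assumes "norm q < 1" "z \<noteq> 0"
  shows "(\<lambda>r. q ^ (Suc r choose 2) * jacobi_poly z r)
    sums (qpoch_inf (- q / z) q * qpoch_inf (- z * q) q * qpoch_inf q q)"
proof -
  define E where "E = qpoch_inf q q"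
  have E: "E \<noteq> 0"
    using qpoch_inf_self_nz[OF assms(1)] by (simp add: E_def)
  obtain B where B: "B > 0" "\<And>n r. norm (bailey_kernel q n r) \<le> B"
    using norm_bailey_kernel_le[OF assms(1)] by blast
  obtain K where K: "K > 0" "\<And>r. norm (jacobi_poly z r) \<le> K ^ r"
    using norm_jacobi_poly_le by blast
  define a where "a r n = q ^ (Suc r choose 2) * bailey_kernel q n r * jacobi_poly z r" for r n
  define b where "b r = q ^ (Suc r choose 2) * (inverse E * inverse E) * jacobi_poly z r" for r
  have lim: "(\<lambda>n. a r n) \<longlonglongrightarrow> b r" for r
  proof -
    have "(\<lambda>n. inverse (qpoch q q n) * inverse (qpoch q q (n + (2 * r + 1)))) \<longlonglongrightarrow> inverse E * inverse E"
      unfolding E_def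
      by (intro tendsto_mult inverse_qpoch_self_tendsto assms
          LIMSEQ_ignore_initial_segment[OF inverse_qpoch_self_tendsto])
    then have "(\<lambda>n. bailey_kernel q (n + r) r) \<longlonglongrightarrow> inverse E * inverse E"
      by (simp add: bailey_kernel_def mult_2 add.assoc)
    then have "(\<lambda>n. bailey_kernel q n r) \<longlonglongrightarrow> inverse E * inverse E"
      by (rule LIMSEQ_offset)
    then show ?thesis
      unfolding a_def b_def by (intro tendsto_intros)
  qed
  have bound: "norm (a r n) \<le> B * (norm q ^ (Suc r choose 2) * K ^ r)" for r n
  proof -
    have "norm (a r n) = norm q ^ (Suc r choose 2) * norm (bailey_kernel q n r) * norm (jacobi_poly z r)"
      by (simp add: a_def norm_mult norm_power)
    also have "\<dots> \<le> norm q ^ (Suc r choose 2) * B * K ^ r"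
      using B K by (intro mult_mono) auto
    finally show ?thesis by (simp add: mult_ac)
  qed
  have summable: "summable (\<lambda>r. B * (norm q ^ (Suc r choose 2) * K ^ r))"
    using assms K by (intro summable_mult summable_power_Suc_choose_2) auto
  note tannery = tannery_sequentially[OF lim bound summable]
  have "(\<Sum>r. a r n) = qpoch (- q / z) q n * qpoch (- z * q) q n / qpoch q q (2 * n + 1)" for n
    unfolding a_def by (rule sums_unique[symmetric, OF finite_jacobi_triple_product_sums[OF assms]])
  moreover have "(\<lambda>n. qpoch (- q / z) q n * qpoch (- z * q) q n / qpoch q q (2 * n + 1))
      \<longlonglongrightarrow> qpoch_inf (- q / z) q * qpoch_inf (- z * q) q / E"
  proof (intro tendsto_divide tendsto_mult qpoch_tendsto_qpoch_inf assms E)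
    have "strict_mono (\<lambda>n::nat. 2 * n + 1)"
      by (auto simp: strict_mono_def)
    from LIMSEQ_subseq_LIMSEQ[OF qpoch_tendsto_qpoch_inf[OF assms(1)] this]
    show "(\<lambda>n. qpoch q q (2 * n + 1)) \<longlonglongrightarrow> E"
      by (simp add: o_def E_def)
  qed
  ultimately have "suminf b = qpoch_inf (- q / z) q * qpoch_inf (- z * q) q / E"
    using tannery(2) by (simp add: LIMSEQ_unique)
  then have "b sums (qpoch_inf (- q / z) q * qpoch_inf (- z * q) q / E)"
    using tannery(1) by (simp add: sums_iff)
  then have "(\<lambda>r. E * E * b r) sums (E * E * (qpoch_inf (- q / z) q * qpoch_inf (- z * q) q / E))"
    by (rule sums_mult)
  then show ?thesis
    using E by (simp add: b_def E_def[symmetric] field_simps)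
qed

section \<open>The limiting q-Gauss sum\<close>

text \<open>
  The terms of \<open>\<Sum>\<^sub>m (a)\<^sub>m (-b)\<^sup>m q\<^sup>m\<^sup>(\<^sup>m\<^sup>-\<^sup>1\<^sup>)\<^sup>/\<^sup>2 / ((q)\<^sub>m (a b)\<^sub>m)\<close> with \<open>a b = q\<^sup>k\<^sup>+\<^sup>1\<close>, up to the factor
  \<open>(q)\<^sub>k\<close>. Writing \<open>(a)\<^sub>m b\<^sup>m\<close> as a product of the factors \<open>b - a b q\<^sup>j\<close> admits the degenerate
  case \<open>b = 0\<close>.
\<close>

definition q_gauss_term :: "complex \<Rightarrow> complex \<Rightarrow> nat \<Rightarrow> nat \<Rightarrow> complex" where
  "q_gauss_term q b k m = (\<Prod>j<m. q ^ (k + j + 1) - b) * q ^ (m choose 2)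
     * inverse (qpoch q q m) * inverse (qpoch q q (m + k))"

text \<open>A contiguous relation with certificate \<open>1 - q ^ m\<close>. The shift of
  \<open>b\<close> and \<open>k\<close> together keeps the parameter \<open>a\<close> of
  \<open>a b = q^(k+1)\<close> fixed, and both other terms are rational multiples of
  \<open>q_gauss_term q b k m\<close>.\<close>

lemma q_gauss_term_telescope:
  assumes "norm q < 1"
  shows "q_gauss_term q b k m - (1 - b) * q_gauss_term q (b * q) (Suc k) m
    = (1 - q ^ m) * q_gauss_term q b k m - (1 - q ^ Suc m) * q_gauss_term q b k (Suc m)"
proof -
  define P where "P = (\<Prod>j<m. q ^ (k + j + 1) - b)"
  define I where "I = inverse (qpoch q q m)"
  define J where "J = inverse (qpoch q q (m + k))"
  define T where "T = q_gauss_term q b k m"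
  define x where "x = q ^ m"
  define w where "w = q ^ (m choose 2)"
  define c where "c = q ^ (k + m + 1)"
  note nz = one_minus_mult_power_nz[OF assms]
  have c: "1 - c \<noteq> 0"
    using nz[of "k + m"] by (simp add: c_def)
  have u: "1 - q * x \<noteq> 0"
    using nz[of m] by (simp add: x_def)
  have T: "T = P * w * I * J"
    by (simp add: T_def q_gauss_term_def P_def w_def I_def J_def)
  have J': "inverse (qpoch q q (Suc (m + k))) = J / (1 - c)"
    by (simp add: J_def c_def add.commute divide_inverse)
  have I': "inverse (qpoch q q (Suc m)) = I / (1 - q * x)"
    by (simp add: I_def x_def divide_inverse)
  have "(\<Prod>j<m. q ^ (Suc k + j + 1) - b * q) = (\<Prod>j<m. q * (q ^ (k + j + 1) - b))"
    by (intro prod.cong refl) (simp add: algebra_simps)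
  also have "\<dots> = q ^ m * (\<Prod>j<m. q ^ (k + j + 1) - b)"
    by (simp add: prod.distrib)
  finally have T1: "q_gauss_term q (b * q) (Suc k) m = T * x / (1 - c)"
    unfolding q_gauss_term_def add_Suc_right J' P_def[symmetric] I_def[symmetric] x_def[symmetric]
    by (simp add: T w_def)
  have "q_gauss_term q b k (Suc m) = P * (c - b) * (w * x) * (I / (1 - q * x)) * (J / (1 - c))"
    unfolding q_gauss_term_def add_Suc J' I' choose_2_Suc power_add P_def c_def w_def x_def
    by simp
  moreover have "u * (P * C * (w * x) * (I / u) * (J / v)) = P * w * I * J * x * C / v"
    if "u \<noteq> 0" for u v C :: complex
    using that by simp
  ultimately have T2: "(1 - q ^ Suc m) * q_gauss_term q b k (Suc m) = T * x * (c - b) / (1 - c)"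
    using u by (simp only: T x_def[symmetric] power_Suc)
  then show ?thesis
    unfolding T1 T2 T_def[symmetric] x_def[symmetric] using c by (simp add: divide_simps) algebra
qed

text \<open>Uniformity in \<open>k\<close>, with \<open>b\<close> entering only through its norm,
  makes this a majorant for all iterated shifts at once.\<close>

lemma norm_q_gauss_term_le:
  assumes "norm q < 1"
  obtains B where "B > 0"
    "\<And>b k m. norm (q_gauss_term q b k m) \<le> B * (norm q ^ (m choose 2) * (1 + norm b) ^ m)"
proof -
  obtain B where B: "B > 0" "\<And>n. norm (inverse (qpoch q q n)) \<le> B"
    using inverse_qpoch_self_bounded[OF assms] by blast
  have "norm (q_gauss_term q b k m) \<le> B * B * (norm q ^ (m choose 2) * (1 + norm b) ^ m)" for b k m
  proof -
    have "norm (q ^ (k + j + 1) - b) \<le> 1 + norm b" for j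
    proof -
      have "norm (q ^ (k + j + 1)) \<le> 1"
        unfolding norm_power using assms by (intro power_le_one) auto
      then show ?thesis using norm_triangle_ineq4[of "q ^ (k + j + 1)" b] by linarith
    qed
    then have "norm (\<Prod>j<m. q ^ (k + j + 1) - b) \<le> (\<Prod>j<m. 1 + norm b)"
      unfolding prod_norm[symmetric] by (intro prod_mono) auto
    then have "norm (\<Prod>j<m. q ^ (k + j + 1) - b) \<le> (1 + norm b) ^ m"
      by simp
    then have "norm (q_gauss_term q b k m) \<le> (1 + norm b) ^ m * norm q ^ (m choose 2) * B * B"
      unfolding q_gauss_term_def norm_mult norm_power using B by (intro mult_mono) auto
    then show ?thesis by (simp add: mult_ac)
  qed
  with B show ?thesis by (intro that[of "B * B"]) auto
qed

lemma q_gauss_term_summable: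
  assumes "norm q < 1"
  shows "summable (q_gauss_term q b k)"
proof -
  obtain B where B: "B > 0"
    "\<And>b k m. norm (q_gauss_term q b k m) \<le> B * (norm q ^ (m choose 2) * (1 + norm b) ^ m)"
    using norm_q_gauss_term_le[OF assms] by blast
  have "summable (\<lambda>m. B * (norm q ^ (m choose 2) * (1 + norm b) ^ m))"
    using assms by (intro summable_mult summable_power_choose_2) auto
  then show ?thesis
    by (rule summable_comparison_test') (rule B(2))
qed

text \<open>The telescoping function \<open>(1 - q ^ m) * q_gauss_term q b k m\<close> is 0 at
  \<open>m = 0\<close> and tends to 0, so the differences sum to 0.\<close>

lemma suminf_q_gauss_term_shift:
  assumes "norm q < 1"
  shows "suminf (q_gauss_term q b k) = (1 - b) * suminf (q_gauss_term q (b * q) (Suc k))"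
proof -
  let ?G = "\<lambda>m. (1 - q ^ m) * q_gauss_term q b k m"
  have "?G \<longlonglongrightarrow> (1 - 0) * 0"
    by (intro tendsto_intros LIMSEQ_power_zero assms summable_LIMSEQ_zero q_gauss_term_summable)
  then have "(\<lambda>m. ?G m - ?G (Suc m)) sums (?G 0 - (1 - 0) * 0)"
    by (rule telescope_sums')
  then have "(\<lambda>m. q_gauss_term q b k m - (1 - b) * q_gauss_term q (b * q) (Suc k) m) sums 0"
    by (simp add: q_gauss_term_telescope[OF assms])
  moreover have "(\<lambda>m. q_gauss_term q b k m - (1 - b) * q_gauss_term q (b * q) (Suc k) m) sums
      (suminf (q_gauss_term q b k) - (1 - b) * suminf (q_gauss_term q (b * q) (Suc k)))"
    by (intro sums_diff sums_mult summable_sums q_gauss_term_summable assms)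
  ultimately show ?thesis
    using sums_unique2 by fastforce
qed

text \<open>Iterating the shift \<open>N\<close> times pulls out \<open>qpoch b q N\<close>. In the
  limit \<open>b * q ^ N\<close> and \<open>q ^ (k + N)\<close> tend to 0, so that only the term
  \<open>m = 0\<close> survives and contributes \<open>1 / (q)_inf\<close>.\<close>

lemma q_gauss_sum:
  assumes "norm q < 1"
  shows "q_gauss_term q b k sums (qpoch_inf b q / qpoch_inf q q)"
proof -
  define E where "E = qpoch_inf q q"
  obtain B where B: "B > 0"
    "\<And>b k m. norm (q_gauss_term q b k m) \<le> B * (norm q ^ (m choose 2) * (1 + norm b) ^ m)"
    using norm_q_gauss_term_le[OF assms] by blast
  \<comment> \<open>The unsimplified \<open>0 - b * 0\<close> is the shape that the limit rules
    produce; the product is 0 unless \<open>m = 0\<close>.\<close>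
  define l where "l m = (\<Prod>j<m. 0 - b * 0) * q ^ (m choose 2) * inverse (qpoch q q m) * inverse E" for m
  have iterate: "suminf (q_gauss_term q b k)
      = qpoch b q N * suminf (q_gauss_term q (b * q ^ N) (k + N))" for N
  proof (induction N)
    case (Suc N)
    then show ?case
      using suminf_q_gauss_term_shift[OF assms, of "b * q ^ N" "k + N"] by (simp add: mult_ac)
  qed simp
  have lim: "(\<lambda>N. q_gauss_term q (b * q ^ N) (k + N) m) \<longlonglongrightarrow> l m" for m
    unfolding q_gauss_term_def l_def
  proof (intro tendsto_mult tendsto_prod tendsto_diff tendsto_const LIMSEQ_power_zero assms)
    show "(\<lambda>N. q ^ (k + N + j + 1)) \<longlonglongrightarrow> 0" for j
      using LIMSEQ_ignore_initial_segment[OF LIMSEQ_power_zero[OF assms], of "k + j + 1"]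
      by (simp add: ac_simps)
    show "(\<lambda>N. inverse (qpoch q q (m + (k + N)))) \<longlonglongrightarrow> inverse E"
      using LIMSEQ_ignore_initial_segment[OF inverse_qpoch_self_tendsto[OF assms], of "m + k"]
      by (simp add: ac_simps E_def)
  qed
  have bound: "norm (q_gauss_term q (b * q ^ N) (k + N) m)
      \<le> B * (norm q ^ (m choose 2) * (1 + norm b) ^ m)" for m N
  proof -
    have "norm (b * q ^ N) \<le> norm b"
      unfolding norm_mult norm_power using assms by (intro mult_left_le power_le_one) auto
    then have "B * (norm q ^ (m choose 2) * (1 + norm (b * q ^ N)) ^ m)
        \<le> B * (norm q ^ (m choose 2) * (1 + norm b) ^ m)"
      using B(1) by (intro mult_left_mono power_mono) auto
    with B(2) show ?thesis by (rule order_trans)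
  qed
  have summable: "summable (\<lambda>m. B * (norm q ^ (m choose 2) * (1 + norm b) ^ m))"
    using assms by (intro summable_mult summable_power_choose_2) auto
  have "suminf l = (\<Sum>m\<in>{0}. l m)"
    by (rule suminf_finite) (auto simp: l_def)
  then have "suminf l = inverse E"
    by (simp add: l_def numeral_2_eq_2)
  then have "(\<lambda>N. suminf (q_gauss_term q (b * q ^ N) (k + N))) \<longlonglongrightarrow> inverse E"
    using tannery_sequentially(2)[OF lim bound summable] by simp
  then have "(\<lambda>N. qpoch b q N * suminf (q_gauss_term q (b * q ^ N) (k + N))) \<longlonglongrightarrow> qpoch_inf b q * inverse E"
    by (intro tendsto_mult qpoch_tendsto_qpoch_inf assms)
  then have "suminf (q_gauss_term q b k) = qpoch_inf b q * inverse E"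
    unfolding iterate[symmetric] by (rule LIMSEQ_unique[OF tendsto_const])
  with q_gauss_term_summable[OF assms, of b k] show ?thesis
    by (simp add: sums_iff E_def divide_inverse)
qed

section \<open>Summing against the Bailey kernel\<close>

lemma qpoch_mult_qpoch_inf:
  assumes "norm p < 1"
  shows "qpoch a p n * qpoch_inf (a * p ^ n) p = qpoch_inf a p"
proof -
  have "(\<lambda>m. qpoch a p n * qpoch (a * p ^ n) p m) \<longlonglongrightarrow> qpoch a p n * qpoch_inf (a * p ^ n) p"
    by (intro tendsto_intros qpoch_tendsto_qpoch_inf assms)
  moreover have "(\<lambda>m. qpoch a p (m + n)) \<longlonglongrightarrow> qpoch_inf a p"
    by (intro LIMSEQ_ignore_initial_segment qpoch_tendsto_qpoch_inf assms)
  ultimately show ?thesis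
    by (simp add: qpoch_add add.commute[of _ n] LIMSEQ_unique)
qed

text \<open>The kernel vanishes for \<open>n < r\<close>, so the sum starts at \<open>n = r\<close>;
  after the shift it is a q-Gauss sum with \<open>k = 2 * r + 1\<close>.\<close>

lemma bailey_kernel_sum:
  assumes "norm q < 1"
    and "\<And>m. w (m + r) * bailey_kernel q (m + r) r = C * q_gauss_term q b (2 * r + 1) m"
  shows "(\<lambda>n. w n * bailey_kernel q n r) sums (C * (qpoch_inf b q / qpoch_inf q q))"
proof -
  have "(\<lambda>m. w (m + r) * bailey_kernel q (m + r) r) sums (C * (qpoch_inf b q / qpoch_inf q q))"
    unfolding assms(2) by (intro sums_mult q_gauss_sum assms(1))
  then show ?thesis
    by (subst (asm) sums_zero_iff_shift) (simp_all add: bailey_kernel_def)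
qed

lemma bailey_kernel_add:
  "bailey_kernel q (m + r) r = inverse (qpoch q q m) * inverse (qpoch q q (m + (2 * r + 1)))"
  by (simp add: bailey_kernel_def mult_2 add.assoc)

text \<open>The case \<open>b = 0\<close>: the product in the q-Gauss term then is a pure power of
  \<open>q\<close> and supplies the second triangular power.\<close>

lemma bailey_kernel_sum_square:
  assumes "norm q < 1"
  shows "(\<lambda>n. q ^ (Suc n choose 2) * q ^ (Suc n choose 2) * bailey_kernel q n r)
    sums (q ^ (Suc r choose 2) * q ^ (Suc r choose 2) / qpoch_inf q q)"
proof -
  define R where "R = q ^ (Suc r choose 2)"
  have "q ^ (Suc (m + r) choose 2) * q ^ (Suc (m + r) choose 2) * bailey_kernel q (m + r) r
      = R * R * q_gauss_term q 0 (2 * r + 1) m" for m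
  proof -
    have "(\<Prod>j<m. q ^ (2 * r + 1 + j + 1) - 0) = (q ^ (r + 1) * q ^ (r + 1)) ^ m * q ^ (m choose 2)"
    proof (induction m)
      case (Suc m)
      have "q ^ (2 * r + 1 + m + 1) = q ^ (r + 1) * q ^ (r + 1) * q ^ m"
        unfolding power_add[symmetric] by (rule arg_cong[where f = "power q"]) simp
      with Suc show ?case
        by (simp only: prod.lessThan_Suc choose_2_Suc power_add power_Suc diff_0_right mult_ac)
    qed (simp add: numeral_2_eq_2)
    moreover have "q ^ (Suc (m + r) choose 2) = q ^ (m choose 2) * R * (q ^ (r + 1)) ^ m"
      unfolding R_def by (rule power_Suc_add_choose_2)
    ultimately show ?thesis
      unfolding q_gauss_term_def bailey_kernel_add power_mult_distrib by (simp only: mult_ac)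
  qed
  from bailey_kernel_sum[OF assms this]
  have "(\<lambda>n. q ^ (Suc n choose 2) * q ^ (Suc n choose 2) * bailey_kernel q n r)
    sums (R * R * (qpoch_inf 0 q / qpoch_inf q q))" .
  then show ?thesis
    by (simp add: R_def qpoch_inf_def)
qed

text \<open>The case \<open>b = - q * q ^ r\<close>: a factor \<open>q ^ (r + 1)\<close> splits off
  each factor of the product and leaves \<open>qpoch (- q * q ^ r) q m\<close>. The prefactor
  \<open>qpoch (- q) q r\<close> completes \<open>qpoch_inf b q\<close> to
  \<open>qpoch_inf (- q) q\<close>, which is free of \<open>r\<close>.\<close>

lemma bailey_kernel_sum_qpoch:
  assumes "norm q < 1"
  shows "(\<lambda>n. q ^ (Suc n choose 2) * qpoch (- q) q n * bailey_kernel q n r)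
    sums (q ^ (Suc r choose 2) * (qpoch_inf (- q) q / qpoch_inf q q))"
proof -
  define R where "R = q ^ (Suc r choose 2)"
  have "q ^ (Suc (m + r) choose 2) * qpoch (- q) q (m + r) * bailey_kernel q (m + r) r
      = R * qpoch (- q) q r * q_gauss_term q (- q * q ^ r) (2 * r + 1) m" for m
  proof -
    have "(\<Prod>j<m. q ^ (2 * r + 1 + j + 1) - - q * q ^ r) = (q ^ (r + 1)) ^ m * qpoch (- q * q ^ r) q m"
    proof (induction m)
      case (Suc m)
      have "q ^ (2 * r + 1 + m + 1) = q ^ (r + 1) * (q * q ^ r * q ^ m)"
        unfolding power_Suc[symmetric] power_add[symmetric] by (rule arg_cong[where f = "power q"]) simp
      then have "q ^ (2 * r + 1 + m + 1) - - q * q ^ r = q ^ (r + 1) * (1 - - q * q ^ r * q ^ m)"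
        by (simp add: algebra_simps)
      with Suc show ?case
        by (simp only: prod.lessThan_Suc qpoch_Suc power_Suc mult_ac)
    qed simp
    moreover have "q ^ (Suc (m + r) choose 2) = q ^ (m choose 2) * R * (q ^ (r + 1)) ^ m"
      unfolding R_def by (rule power_Suc_add_choose_2)
    moreover have "qpoch (- q) q (m + r) = qpoch (- q) q r * qpoch (- q * q ^ r) q m"
      by (simp only: add.commute[of m] qpoch_add)
    ultimately show ?thesis
      unfolding q_gauss_term_def bailey_kernel_add by (simp only: mult_ac)
  qed
  from bailey_kernel_sum[OF assms this]
  have "(\<lambda>n. q ^ (Suc n choose 2) * qpoch (- q) q n * bailey_kernel q n r)
    sums (R * qpoch (- q) q r * (qpoch_inf (- q * q ^ r) q / qpoch_inf q q))" .
  then show ?thesis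
    using qpoch_mult_qpoch_inf[OF assms, of "- q" r, symmetric] by (simp add: R_def mult.assoc)
qed

text \<open>Interchange of the two summations. It suffices that \<open>v\<close> is bounded, since
  the triangular powers in \<open>n\<close> and in \<open>r\<close> dominate everything
  else.\<close>

lemma jacobi_bailey_sum:
  fixes q z :: complex
  assumes q: "norm q < 1" and z: "z \<noteq> 0"
    and v: "\<And>n. norm (v n) \<le> V"
    and inner: "\<And>r. (\<lambda>n. q ^ (Suc n choose 2) * v n * bailey_kernel q n r) sums W r"
    and outer: "(\<lambda>r. q ^ (Suc r choose 2) * jacobi_poly z r * W r) sums S"
  shows "(\<lambda>n. q ^ (Suc n choose 2) * v n
      * (qpoch (- q / z) q n * qpoch (- z * q) q n / qpoch q q (2 * n + 1))) sums S"
proof -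
  obtain B where B: "B > 0" "\<And>n r. norm (bailey_kernel q n r) \<le> B"
    using norm_bailey_kernel_le[OF q] by blast
  obtain K where K: "K > 0" "\<And>r. norm (jacobi_poly z r) \<le> K ^ r"
    using norm_jacobi_poly_le by blast
  have V: "V \<ge> 0"
    using v[of 0] norm_ge_zero order_trans by blast
  define h where "h n = norm q ^ (Suc n choose 2) * V * B" for n
  have h: "summable h"
    using summable_power_Suc_choose_2[of "norm q" 1] q unfolding h_def
    by (intro summable_mult2) auto
  have h_nonneg: "h n \<ge> 0" for n
    using V B by (simp add: h_def)
  \<comment> \<open>Truncating only the sum over \<open>n\<close> reduces the interchange to a limit
    in \<open>N\<close> under the series over \<open>r\<close>.\<close>
  define a where "a r N = q ^ (Suc r choose 2) * jacobi_poly z r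
      * (\<Sum>n<N. q ^ (Suc n choose 2) * v n * bailey_kernel q n r)" for r N
  have lim: "a r \<longlonglongrightarrow> q ^ (Suc r choose 2) * jacobi_poly z r * W r" for r
    using inner[of r] unfolding a_def sums_def by (intro tendsto_intros)
  have bound: "norm (a r N) \<le> suminf h * (norm q ^ (Suc r choose 2) * K ^ r)" for r N
  proof -
    have "norm (\<Sum>n<N. q ^ (Suc n choose 2) * v n * bailey_kernel q n r) \<le> (\<Sum>n<N. h n)"
    proof (intro sum_norm_le)
      fix n
      show "norm (q ^ (Suc n choose 2) * v n * bailey_kernel q n r) \<le> h n"
        unfolding h_def norm_mult norm_power using B v V by (intro mult_mono) auto
    qed
    also have "\<dots> \<le> suminf h"
      by (intro sum_le_suminf h) (auto simp: h_nonneg)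
    finally have "norm (a r N) \<le> norm q ^ (Suc r choose 2) * K ^ r * suminf h"
      unfolding a_def norm_mult norm_power using K
      by (intro mult_mono) auto
    then show ?thesis by (simp add: mult_ac)
  qed
  have summable: "summable (\<lambda>r. suminf h * (norm q ^ (Suc r choose 2) * K ^ r))"
    using q K by (intro summable_mult summable_power_Suc_choose_2) auto
  have "(\<Sum>r. a r N) = (\<Sum>n<N. q ^ (Suc n choose 2) * v n
      * (qpoch (- q / z) q n * qpoch (- z * q) q n / qpoch q q (2 * n + 1)))" for N
  proof -
    have "(\<lambda>r. \<Sum>n<N. q ^ (Suc n choose 2) * v n
        * (q ^ (Suc r choose 2) * bailey_kernel q n r * jacobi_poly z r))
      sums (\<Sum>n<N. q ^ (Suc n choose 2) * v n
        * (qpoch (- q / z) q n * qpoch (- z * q) q n / qpoch q q (2 * n + 1)))"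
      by (intro sums_sum sums_mult finite_jacobi_triple_product_sums q z)
    moreover have "(\<Sum>n<N. q ^ (Suc n choose 2) * v n
        * (q ^ (Suc r choose 2) * bailey_kernel q n r * jacobi_poly z r)) = a r N" for r
      unfolding a_def sum_distrib_left by (intro sum.cong refl) (simp only: mult_ac)
    ultimately show ?thesis
      by (simp only: sums_unique[symmetric])
  qed
  then show ?thesis
    using tannery_sequentially(2)[OF lim bound summable] sums_unique[OF outer]
    unfolding sums_def by simp
qed

section \<open>Euler's product identities\<close>

lemma qpoch_inf_self_mult_neg:
  assumes "norm q < 1"
  shows "qpoch_inf q q * qpoch_inf (- q) q = qpoch_inf (q\<^sup>2) (q\<^sup>2)"
proof -
  have q2: "norm (q\<^sup>2) < 1"
    using assms by (simp add: norm_power power_less_one_iff)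
  have "qpoch q q n * qpoch (- q) q n = qpoch (q\<^sup>2) (q\<^sup>2) n" for n
  proof (induction n)
    case (Suc n)
    have "(1 - q * q ^ n) * (1 - - q * q ^ n) = 1 - q\<^sup>2 * (q\<^sup>2) ^ n"
      by (simp add: algebra_simps power2_eq_square power_mult_distrib)
    with Suc show ?case
      by (simp only: qpoch_Suc) (metis mult.assoc mult.left_commute)
  qed simp
  moreover have "(\<lambda>n. qpoch q q n * qpoch (- q) q n) \<longlonglongrightarrow> qpoch_inf q q * qpoch_inf (- q) q"
    by (intro tendsto_intros qpoch_tendsto_qpoch_inf assms)
  ultimately show ?thesis
    using qpoch_tendsto_qpoch_inf[OF q2, of "q\<^sup>2"] by (simp add: LIMSEQ_unique)
qed

text \<open>The first \<open>2 * n\<close> factors of the right-hand product split according to the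
  parity of the exponent.\<close>

lemma qpoch_inf_odd_even:
  assumes "norm q < 1"
  shows "qpoch_inf q (q\<^sup>2) * qpoch_inf (q\<^sup>2) (q\<^sup>2) = qpoch_inf q q"
proof -
  have q2: "norm (q\<^sup>2) < 1"
    using assms by (simp add: norm_power power_less_one_iff)
  have "qpoch q (q\<^sup>2) n * qpoch (q\<^sup>2) (q\<^sup>2) n = qpoch q q (2 * n)" for n
  proof (induction n)
    case (Suc n)
    have "(q\<^sup>2) ^ n = q ^ (2 * n)" by (simp only: power_mult)
    with Suc show ?case
      by (simp add: power2_eq_square mult_ac)
  qed simp
  moreover have "(\<lambda>n. qpoch q (q\<^sup>2) n * qpoch (q\<^sup>2) (q\<^sup>2) n) \<longlonglongrightarrow> qpoch_inf q (q\<^sup>2) * qpoch_inf (q\<^sup>2) (q\<^sup>2)"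
    by (intro tendsto_intros qpoch_tendsto_qpoch_inf q2)
  moreover have "(\<lambda>n. qpoch q q (2 * n)) \<longlonglongrightarrow> qpoch_inf q q"
    using LIMSEQ_subseq_LIMSEQ[OF qpoch_tendsto_qpoch_inf[OF assms], of "\<lambda>n. 2 * n"]
    by (simp add: o_def strict_mono_def)
  ultimately show ?thesis
    by (simp add: LIMSEQ_unique)
qed

theorem theorem3p2:
  fixes q z :: complex
  assumes "norm q < 1" and "z \<noteq> 0"
  shows "((\<lambda>n. qpochs [- q / z, - z * q] q n / qpoch q q (2 * n + 1) * q ^ (n * (n + 1)))
           sums (qpochs_inf [- (q ^ 3) / z, - z * q ^ 3, q ^ 3] (q ^ 3) / qpoch_inf q q))
       \<and> ((\<lambda>n. qpochs [- q / z, - z * q, - q] q n / qpoch q q (2 * n + 1) * q ^ ((n + 1) choose 2))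
           sums (qpochs_inf [- (q ^ 2) / z, - z * q ^ 2] (q ^ 2) / (qpoch_inf q (q ^ 2)) ^ 2))"
proof
  define J where "J p = qpoch_inf (- p / z) p * qpoch_inf (- z * p) p * qpoch_inf p p" for p
  have p: "norm (q ^ 3) < 1" "norm (q\<^sup>2) < 1"
    using assms by (simp_all add: norm_power power_less_one_iff)
  note triple = jacobi_triple_product[OF _ assms(2), folded J_def]

  have "norm (q ^ (Suc n choose 2)) \<le> 1" for n
    unfolding norm_power using assms by (intro power_le_one) auto
  \<comment> \<open>Three equal triangular powers of \<open>q\<close> make one triangular power of
    \<open>q ^ 3\<close>, hence the triple product in that base.\<close>
  moreover have "(\<lambda>r. q ^ (Suc r choose 2) * jacobi_poly z r
      * (q ^ (Suc r choose 2) * q ^ (Suc r choose 2) / qpoch_inf q q)) sums (J (q ^ 3) / qpoch_inf q q)"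
    using sums_divide[OF triple[OF p(1)], of "qpoch_inf q q"]
    by (simp add: power3_eq_cube power_mult_distrib mult_ac)
  ultimately have "(\<lambda>n. q ^ (Suc n choose 2) * q ^ (Suc n choose 2)
      * (qpoch (- q / z) q n * qpoch (- z * q) q n / qpoch q q (2 * n + 1)))
      sums (J (q ^ 3) / qpoch_inf q q)"
    using jacobi_bailey_sum[OF assms _ bailey_kernel_sum_square[OF assms(1)]] by blast
  moreover have "q ^ (n * (n + 1)) = q ^ (Suc n choose 2) * q ^ (Suc n choose 2)" for n
    unfolding Suc_choose_2_double[symmetric] mult_2 power_add ..
  ultimately show "(\<lambda>n. qpochs [- q / z, - z * q] q n / qpoch q q (2 * n + 1) * q ^ (n * (n + 1)))
      sums (qpochs_inf [- (q ^ 3) / z, - z * q ^ 3, q ^ 3] (q ^ 3) / qpoch_inf q q)"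
    by (simp add: qpochs_def qpochs_inf_def J_def mult_ac)

  obtain V where V: "\<And>n. norm (qpoch (- q) q n) \<le> V"
  proof -
    have "Bseq (qpoch (- q) q)"
      using qpoch_tendsto_qpoch_inf[OF assms(1)] by (intro convergent_imp_Bseq) (auto simp: convergent_def)
    then show ?thesis
      using that by (auto elim!: BseqE)
  qed
  define c where "c = qpoch_inf (- q) q / qpoch_inf q q"
  \<comment> \<open>Here the inner sum adds only one triangular power, so the base is
    \<open>q\<^sup>2\<close>.\<close>
  have "(\<lambda>r. q ^ (Suc r choose 2) * jacobi_poly z r * (q ^ (Suc r choose 2) * c)) sums (J (q\<^sup>2) * c)"
    using sums_mult2[OF triple[OF p(2)], of c]
    by (simp add: power2_eq_square power_mult_distrib mult_ac)
  from jacobi_bailey_sum[OF assms V bailey_kernel_sum_qpoch[OF assms(1), folded c_def] this]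
  have "(\<lambda>n. q ^ (Suc n choose 2) * qpoch (- q) q n
      * (qpoch (- q / z) q n * qpoch (- z * q) q n / qpoch q q (2 * n + 1))) sums (J (q\<^sup>2) * c)" .
  moreover have "J (q\<^sup>2) * c
      = qpoch_inf (- q\<^sup>2 / z) (q\<^sup>2) * qpoch_inf (- z * q\<^sup>2) (q\<^sup>2) / (qpoch_inf q (q\<^sup>2))\<^sup>2"
  proof -
    define Q D E F where "Q = qpoch_inf (q\<^sup>2) (q\<^sup>2)" and "D = qpoch_inf q (q\<^sup>2)"
      and "E = qpoch_inf q q" and "F = qpoch_inf (- q) q"
    have eqs: "E * F = Q" "D * Q = E"
      using qpoch_inf_self_mult_neg[OF assms(1)] qpoch_inf_odd_even[OF assms(1)]
      by (simp_all add: Q_def D_def E_def F_def)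
    have nz: "E \<noteq> 0"
      using qpoch_inf_self_nz[OF assms(1)] by (simp add: E_def)
    \<comment> \<open>Cancelling \<open>E\<close> in \<open>D * (E * F) = E\<close> gives Euler's
      identity \<open>D * F = 1\<close>. Hence \<open>Q * (F / E)\<close>, which is the square of
      \<open>F\<close>, equals the inverse square of \<open>D\<close>.\<close>
    then have "D \<noteq> 0" "D * F = 1"
      using eqs by auto
    then have "Q * (F / E) = 1 / D\<^sup>2"
      using nz eqs by (simp add: field_simps power2_eq_square)
    then have "x * y * Q * (F / E) = x * y / D\<^sup>2" for x y
      by (metis mult.assoc mult.right_neutral times_divide_eq_right)
    then show ?thesis
      by (simp only: J_def c_def Q_def D_def E_def F_def)
  qed
  ultimately show "(\<lambda>n. qpochs [- q / z, - z * q, - q] q n / qpoch q q (2 * n + 1) * q ^ ((n + 1) choose 2))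
      sums (qpochs_inf [- (q ^ 2) / z, - z * q ^ 2] (q ^ 2) / (qpoch_inf q (q ^ 2)) ^ 2)"
    by (simp add: qpochs_def qpochs_inf_def mult_ac)
qed

end
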